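(* Let $I$ be a finite set of reals and let $S=(s_1,\dots,s_r)$ be a sequence with $s_i\in I$ for all $i\in[r]$. If $r\ge 4|I|$, then $S$ has a mutable quadruple, i.e. there is an index $j$ with $1\le j\le r-3$ such that $s_{j+2}\ge s_j$ and $s_{j+1}\ge s_{j+3}$. *)

theory Defs
  imports Complex_Main
begin

(* A sequence (s_1, ..., s_r) is represented by its length r and a function s on nat;
   only the values at the indices 1, ..., r are relevant.  The bound j + 3 <= r expresses
   j <= r - 3 without truncated subtraction. *)
definition mutable_quadruple_at :: "nat \<Rightarrow> (nat \<Rightarrow> real) \<Rightarrow> nat \<Rightarrow> bool" where
  "mutable_quadruple_at r s j \<longleftrightarrow>
     1 \<le> j \<and> j + 3 \<le> r \<and> s (j + 2) \<ge> s j \<and> s (j + 1) \<ge> s (j + 3)"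

definition has_mutable_quadruple :: "nat \<Rightarrow> (nat \<Rightarrow> real) \<Rightarrow> bool" where
  "has_mutable_quadruple r s \<longleftrightarrow> (\<exists>j. mutable_quadruple_at r s j)"

end

(* Without a mutable quadruple, s j <= s (j + 2) forces s (j + 1) < s (j + 3); so once one step of
   length two is not strictly decreasing, all later ones are strictly increasing.  With n = card I,
   according to the step from 2n - 1 to 2n + 1, either s_1 > s_3 > ... > s_(2n+1) or
   s_(2n) < s_(2n+2) < ... < s_(4n): n + 1 distinct values in I in both cases. *)
theory Submission imports Defs begin

lemma less_card_of_chain:
  fixes t :: "nat \<Rightarrow> 'a :: linorder"
  assumes "finite A"
    and step: "\<And>k. k < n \<Longrightarrow> t k < t (Suc k)"
    and mem: "\<And>k. k \<le> n \<Longrightarrow> t k \<in> A"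
  shows "n < card A"
proof -
  have less: "t i < t j" if "i < j" "j \<le> n" for i j
    using that
  proof (induction j)
    case (Suc j)
    then show ?case
      using step[of j] by (cases "i = j") (auto intro: less_trans)
  qed simp
  have "inj_on t {..n}"
    by (rule linorder_inj_onI) (use less in \<open>force simp: linear\<close>)+
  then have "card (t ` {..n}) = Suc n"
    by (simp add: card_image)
  moreover have "card (t ` {..n}) \<le> card A"
    using mem by (intro card_mono \<open>finite A\<close>) auto
  ultimately show ?thesis by simp
qed

text \<open>Induction on \<open>k\<close>: excluding a quadruple at \<open>j + k\<close> makes the
  next step strictly increasing. The conclusion stays non-strict so that \<open>k = 0\<close> is the
  assumption itself.\<close>

lemma nondecreasing_step_propagates:
  assumes no: "\<not> has_mutable_quadruple r s"
    and "1 \<le> j" and "s j \<le> s (j + 2)" and "j + k + 2 \<le> r"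
  shows "s (j + k) \<le> s (j + k + 2)"
  using \<open>j + k + 2 \<le> r\<close>
proof (induction k)
  case (Suc k)
  then have "s (j + k) \<le> s (j + k + 2)" by simp
  then have "\<not> s (j + k + 3) \<le> s (j + k + 1)"
    using no \<open>1 \<le> j\<close> Suc.prems
    by (auto simp: has_mutable_quadruple_def mutable_quadruple_at_def)
  then show ?case by (simp add: eval_nat_numeral)
qed (use assms in simp)

theorem theorem37:
  fixes I :: "real set" and r :: nat and s :: "nat \<Rightarrow> real"
  assumes "finite I"
    and "1 \<le> r"
    and "\<And>i. i \<in> {1..r} \<Longrightarrow> s i \<in> I"
    and "r \<ge> 4 * card I"
  shows "has_mutable_quadruple r s"
proof (rule ccontr)
  assume no: "\<not> has_mutable_quadruple r s"
  define n where "n = card I"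
  \<comment> \<open>This makes \<open>I\<close> nonempty, so that \<open>2 * n - 1\<close> below is
    not truncated.\<close>
  have "s 1 \<in> I" using assms by simp
  then have n: "1 \<le> n" "4 * n \<le> r"
    using assms by (auto simp: n_def Suc_le_eq card_gt_0_iff)
  define m where "m = 2 * n - 1"
  have m: "1 \<le> m" "m + 1 = 2 * n" using n by (auto simp: m_def)
  have "n < card I"
  proof (cases "s m \<le> s (m + 2)")
    case True
    show ?thesis
    proof (rule less_card_of_chain[where t = "\<lambda>k. s (2 * n + 2 * k)"])
      fix k assume "k < n"
      then have "s (m + 2 * k) \<le> s (m + 2 * k + 2)"
        using m n by (intro nondecreasing_step_propagates[OF no _ True]) auto
      \<comment> \<open>The step from \<open>m + 2 * k\<close> may be an equality; excluding a
        quadruple there makes the step from the next, even index strict. It ends at most at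
        \<open>4 * n\<close>.\<close>
      then have "\<not> s (m + 2 * k + 3) \<le> s (m + 2 * k + 1)"
        using no m n \<open>k < n\<close>
        by (auto simp: has_mutable_quadruple_def mutable_quadruple_at_def)
      moreover have "m + 2 * k + 3 = 2 * n + 2 * Suc k" "m + 2 * k + 1 = 2 * n + 2 * k"
        using m by auto
      ultimately show "s (2 * n + 2 * k) < s (2 * n + 2 * Suc k)"
        by (metis not_le)
    qed (use assms n in auto)
  next
    case False
    \<comment> \<open>The odd indices are listed downwards from \<open>2 * n + 1\<close> to 1, so
      that the chain increases; \<open>k \<le> n\<close> keeps the subtraction exact.\<close>
    show ?thesis
    proof (rule less_card_of_chain[where t = "\<lambda>k. s (2 * n + 1 - 2 * k)"])
      fix k assume "k < n"
      define j where "j = m - 2 * k"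
      have j: "1 \<le> j" "j + 2 * k = m" using \<open>k < n\<close> m by (auto simp: j_def)
      \<comment> \<open>Otherwise this step would propagate \<open>2 * k\<close> places to
        \<open>m\<close>, against the case assumption.\<close>
      have "\<not> s j \<le> s (j + 2)"
        using nondecreasing_step_propagates[OF no \<open>1 \<le> j\<close>, of "2 * k"] False j m n by auto
      moreover have "2 * n + 1 - 2 * k = j + 2" "2 * n + 1 - 2 * Suc k = j"
        using j m by auto
      ultimately show "s (2 * n + 1 - 2 * k) < s (2 * n + 1 - 2 * Suc k)"
        by (metis not_le)
    qed (rule assms(1), rule assms(3), use n in \<open>simp, linarith\<close>)
  qed
  then show False by (simp add: n_def)
qed

end
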